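(* (a) Let $x^*$ be a strict local minimum of the cardinality constrained problem (P). Then there exist $r>0$ and $T>0$ such that for all $t\in(0,T]$ the regularized program $\mathrm{NLP}(t)$ has a local minimum $(x^t,y^t)$ with $x^t\in B_r(x^* )$. (b) Let $(x^*,y^* )$ be a strict local minimum of the reformulation (R) with respect to $x$ and let $\|x^*\|_0=\kappa$. Then there exist $r>0$ and $T>0$ such that for all $t\in(0,T]$ the regularized program $\mathrm{NLP}(t)$ has a local minimum $(x^t,y^t)$ with $x^t\in B_r(x^* )$.
   Context: Setting. $f:\mathbb{R}^n\to\mathbb{R}$, $g:\mathbb{R}^n\to\mathbb{R}^m$, $h:\mathbb{R}^n\to\mathbb{R}^p$ are continuously differentiable, $\kappa<n$ is an integer, $X=\{x\in\mathbb{R}^n\mid g(x)\le 0,\ h(x)=0\}$, $\|x\|_0$ is the number of nonzero components of $x$, and $\{x\in X\mid \|x\|_0\le\kappa\}\neq\emptyset$. The cardinality constrained problem (P) is: minimize $f(x)$ subject to $x\in X$, $\|x\|_0\le\kappa$. The reformulation (R) is: minimize $f(x)$ over $(x,y)\in\mathbb{R}^n\times\mathbb{R}^n$ subject to $g(x)\le0$, $h(x)=0$, $0\le y\le e$, $e^Ty\ge n-\kappa$, $x\circ y=0$, where $e$ is the all-ones vector and $\circ$ is the componentwise product. $Z$ denotes the feasible set of (R). $B_r(\cdot)$ is an open ball of radius $r$ with respect to an arbitrary norm. For $t\ge0$ the (Scholtes-)regularized program $\mathrm{NLP}(t)$ is: minimize $f(x)$ over $(x,y)\in\mathbb{R}^n\times\mathbb{R}^n$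 subject to $g(x)\le0$, $h(x)=0$, $0\le y\le e$, $e^Ty\ge n-\kappa$, $-te\le x\circ y\le te$. $x^*$ is a strict local minimum of (P) if it is feasible for (P) and there is $\rho>0$ with $f(x)>f(x^* )$ for all feasible $x\in B_\rho(x^* )\setminus\{x^*\}$. A point $(x^*,y^* )\in Z$ is a strict local minimum with respect to $x$ of (R) if there is $\rho>0$ such that $f(x^* )<f(x)$ for all $(x,y)\in B_\rho(x^*,y^* )\cap Z$ with $x\ne x^*$. *)

theory Defs
  imports "HOL-Analysis.Analysis"
begin

definition continuously_differentiable ::
    "('a::real_normed_vector \<Rightarrow> 'b::real_normed_vector) \<Rightarrow> bool" where
  "continuously_differentiable F \<longleftrightarrow>
    (\<exists>F' :: 'a \<Rightarrow> 'a \<Rightarrow>\<^sub>L 'b.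
      (\<forall>x. (F has_derivative blinfun_apply (F' x)) (at x)) \<and> continuous_on UNIV F')"

text \<open>The library fixes one norm per type, whereas balls here are taken with respect to an
  arbitrary norm \<open>N\<close>.\<close>

definition is_norm :: "('a::real_vector \<Rightarrow> real) \<Rightarrow> bool" where
  "is_norm N \<longleftrightarrow>
    (\<forall>x. 0 \<le> N x) \<and> (\<forall>x. N x = 0 \<longleftrightarrow> x = 0) \<and>
    (\<forall>c x. N (c *\<^sub>R x) = \<bar>c\<bar> * N x) \<and> (\<forall>x y. N (x + y) \<le> N x + N y)"

definition nball :: "('a::real_vector \<Rightarrow> real) \<Rightarrow> 'a \<Rightarrow> real \<Rightarrow> 'a set" where
  "nball N c r = {x. N (x - c) < r}"

definition l0 :: "real ^ 'n \<Rightarrow> nat" where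
  "l0 x = card {i. x $ i \<noteq> 0}"

text \<open>The maps \<open>g\<close> and \<open>h\<close> are given by their component functions \<open>g 0, \<dots>, g (m - 1)\<close> and
  \<open>h 0, \<dots>, h (p - 1)\<close>, so that \<open>m = 0\<close> and \<open>p = 0\<close> (no constraints of that kind) are allowed.\<close>

definition feasX ::
    "nat \<Rightarrow> nat \<Rightarrow> (nat \<Rightarrow> real ^ 'n \<Rightarrow> real) \<Rightarrow> (nat \<Rightarrow> real ^ 'n \<Rightarrow> real) \<Rightarrow> (real ^ 'n) set" where
  "feasX m p g h = {x. (\<forall>i<m. g i x \<le> 0) \<and> (\<forall>j<p. h j x = 0)}"

definition feasP ::
    "nat \<Rightarrow> nat \<Rightarrow> (nat \<Rightarrow> real ^ 'n \<Rightarrow> real) \<Rightarrow> (nat \<Rightarrow> real ^ 'n \<Rightarrow> real) \<Rightarrow> int \<Rightarrow> (real ^ 'n) set" where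
  "feasP m p g h \<kappa> = {x \<in> feasX m p g h. int (l0 x) \<le> \<kappa>}"

text \<open>On \<open>real ^ 'n\<close> the relation \<open>\<le>\<close> and the product \<open>*\<close> are componentwise, and \<open>1\<close> is the
  all-ones vector.\<close>

definition feasR ::
    "nat \<Rightarrow> nat \<Rightarrow> (nat \<Rightarrow> real ^ 'n \<Rightarrow> real) \<Rightarrow> (nat \<Rightarrow> real ^ 'n \<Rightarrow> real) \<Rightarrow> int
      \<Rightarrow> ((real ^ 'n) \<times> (real ^ 'n)) set" where
  "feasR m p g h \<kappa> = {(x, y). x \<in> feasX m p g h \<and> 0 \<le> y \<and> y \<le> 1 \<and>
     1 \<bullet> y \<ge> real CARD('n) - real_of_int \<kappa> \<and> x * y = 0}"

definition feasNLP ::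
    "nat \<Rightarrow> nat \<Rightarrow> (nat \<Rightarrow> real ^ 'n \<Rightarrow> real) \<Rightarrow> (nat \<Rightarrow> real ^ 'n \<Rightarrow> real) \<Rightarrow> int \<Rightarrow> real
      \<Rightarrow> ((real ^ 'n) \<times> (real ^ 'n)) set" where
  "feasNLP m p g h \<kappa> t = {(x, y). x \<in> feasX m p g h \<and> 0 \<le> y \<and> y \<le> 1 \<and>
     1 \<bullet> y \<ge> real CARD('n) - real_of_int \<kappa> \<and>
     - (t *\<^sub>R 1) \<le> x * y \<and> x * y \<le> t *\<^sub>R 1}"

definition local_minimum ::
    "('a::real_vector \<Rightarrow> real) \<Rightarrow> ('a \<Rightarrow> real) \<Rightarrow> 'a set \<Rightarrow> 'a \<Rightarrow> bool" where
  "local_minimum N F S z \<longleftrightarrow> z \<in> S \<and> (\<exists>\<rho>>0. \<forall>w \<in> nball N z \<rho> \<inter> S. F z \<le> F w)"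

definition strict_local_minimum ::
    "('a::real_vector \<Rightarrow> real) \<Rightarrow> ('a \<Rightarrow> real) \<Rightarrow> 'a set \<Rightarrow> 'a \<Rightarrow> bool" where
  "strict_local_minimum N F S z \<longleftrightarrow>
     z \<in> S \<and> (\<exists>\<rho>>0. \<forall>w \<in> (nball N z \<rho> - {z}) \<inter> S. F w > F z)"

definition strict_local_minimum_wrt_x ::
    "('a::real_vector \<times> 'b::real_vector \<Rightarrow> real) \<Rightarrow> ('a \<Rightarrow> real) \<Rightarrow> ('a \<times> 'b) set \<Rightarrow> 'a \<times> 'b \<Rightarrow> bool" where
  "strict_local_minimum_wrt_x N F S z \<longleftrightarrow>
     z \<in> S \<and> (\<exists>\<rho>>0. \<forall>(x, y) \<in> nball N z \<rho> \<inter> S. x \<noteq> fst z \<longrightarrow> F (fst z) < F x)"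

end

theory Submission
  imports Defs
begin

text \<open>
  Every feasible pair of (R) has an \<open>x\<close> that is feasible for (P), and every \<open>x\<close> feasible for (P)
  extends to a feasible pair of (R) by the indicator \<open>y\<close> of its zeros. Hence a strict local minimum
  \<open>xs\<close> of (P) has the property that
  (S) all points \<open>(x, y)\<close> of \<open>Z\<close> with \<open>x\<close> in some closed ball around \<open>xs\<close> and \<open>x \<noteq> xs\<close> satisfy
  \<open>f xs < f x\<close>,
  whatever \<open>y\<close> is. A strict local minimum \<open>(xs, ys)\<close> of (R) with respect to \<open>x\<close> gives this a priori
  only for \<open>y\<close> near \<open>ys\<close>; but if \<open>xs\<close> has exactly \<open>\<kappa>\<close> nonzero components, then every \<open>x\<close> close to
  \<open>xs\<close> and feasible for (P) has the same support as \<open>xs\<close>, and its only possible partner \<open>y\<close> is the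
  indicator of the zeros of \<open>xs\<close>, which is therefore \<open>ys\<close>. So both parts reduce to (S).

  Given (S), let \<open>C\<close> be the closed ball, and minimize \<open>f\<close> over the points of \<open>NLP(t)\<close> with \<open>x\<close>
  in \<open>C\<close>. This set is compact, because \<open>y\<close> ranges over a box, and it contains a point above \<open>xs\<close>.
  A minimizer is a local minimum of \<open>NLP(t)\<close> as soon as its \<open>x\<close> lies in the interior of \<open>C\<close>. On the
  compact set of all \<open>(x, y)\<close> that satisfy the constraints other than \<open>x \<circ> y = 0\<close>, have \<open>x\<close> on the
  bounding sphere and have \<open>f x \<le> f xs\<close>, the quantity \<open>max\<^sub>i \<bar>x\<^sub>i y\<^sub>i\<bar>\<close> has no zero by (S), hence has a
  positive lower bound. For \<open>t\<close> below that bound no point of \<open>NLP(t)\<close> over the sphere can compete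
  with \<open>xs\<close>, so the minimizer is interior.
\<close>

section \<open>Equivalence of norms\<close>

text \<open>The triangle inequality, applied to the expansion in the standard basis.\<close>

lemma is_norm_le_norm:
  fixes N :: "'a::euclidean_space \<Rightarrow> real"
  assumes "is_norm N"
  obtains B where "B > 0" "\<And>x. N x \<le> B * norm x"
proof -
  have nn: "0 \<le> N x" and scale: "N (c *\<^sub>R x) = \<bar>c\<bar> * N x" and tri: "N (x + y) \<le> N x + N y"
    and zero: "N 0 = 0" for x y c
    using assms by (auto simp: is_norm_def)
  have sum: "N (\<Sum>b\<in>I. u b) \<le> (\<Sum>b\<in>I. N (u b))" if "finite I" for I and u :: "'a \<Rightarrow> 'a"
    using that
  proof (induction I)
    case (insert b I)
    then show ?case using tri[of "u b" "\<Sum>b\<in>I. u b"] by simp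
  qed (simp add: zero)
  define B where "B = 1 + (\<Sum>b\<in>Basis. N (b::'a))"
  have "N x \<le> B * norm x" for x
  proof -
    have "N x = N (\<Sum>b\<in>Basis. (x \<bullet> b) *\<^sub>R b)" by (simp add: euclidean_representation)
    also have "\<dots> \<le> (\<Sum>b\<in>Basis. \<bar>x \<bullet> b\<bar> * N b)"
      using sum[of Basis "\<lambda>b. (x \<bullet> b) *\<^sub>R b"] by (simp add: scale)
    also have "\<dots> \<le> (\<Sum>b\<in>Basis. norm x * N b)"
      by (intro sum_mono mult_right_mono Basis_le_norm nn)
    also have "\<dots> = (\<Sum>b\<in>Basis. N (b::'a)) * norm x" by (simp add: sum_distrib_left mult.commute)
    also have "\<dots> \<le> B * norm x" by (simp add: B_def mult_right_mono)
    finally show ?thesis .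
  qed
  moreover have "B > 0" unfolding B_def by (simp add: add_pos_nonneg sum_nonneg nn)
  ultimately show ?thesis using that by blast
qed

lemma continuous_on_is_norm:
  fixes N :: "'a::euclidean_space \<Rightarrow> real"
  assumes "is_norm N"
  shows "continuous_on S N"
proof -
  obtain B where B: "B > 0" "\<And>x. N x \<le> B * norm x" using is_norm_le_norm[OF assms] by blast
  have tri: "N (x + y) \<le> N x + N y" for x y using assms by (auto simp: is_norm_def)
  have le: "N x - N y \<le> B * dist x y" for x y
    using tri[of "x - y" y] B(2)[of "x - y"] by (simp add: dist_norm)
  have "B-lipschitz_on S N"
    using le B(1) by (auto intro!: lipschitz_onI simp: dist_real_def abs_le_iff) (metis dist_commute)
  then show ?thesis by (rule lipschitz_on_continuous_on)
qed

text \<open>Conversely, \<open>N\<close> is continuous and positive on the compact unit sphere.\<close>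

lemma norm_le_is_norm:
  fixes N :: "'a::euclidean_space \<Rightarrow> real"
  assumes "is_norm N"
  obtains A where "A > 0" "\<And>x. A * norm x \<le> N x"
proof -
  have "sphere (0::'a) 1 \<noteq> {}" by simp
  then obtain u :: 'a where u: "norm u = 1" "\<And>v. norm v = 1 \<Longrightarrow> N u \<le> N v"
    using continuous_attains_inf[OF compact_sphere _ continuous_on_is_norm[OF assms], of 0 1] by auto
  have N: "0 \<le> N x" "N x = 0 \<longleftrightarrow> x = 0" "N (c *\<^sub>R x) = \<bar>c\<bar> * N x" for x c
    using assms by (auto simp: is_norm_def)
  have "u \<noteq> 0" using u(1) by auto
  then have "N u > 0" using N(1)[of u] N(2)[of u] by linarith
  moreover have "N u * norm x \<le> N x" for x
  proof (cases "x = 0")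
    case False
    then have "N u \<le> N ((1 / norm x) *\<^sub>R x)" by (intro u(2)) simp
    with False show ?thesis by (simp add: N(3) field_simps)
  qed (simp add: N(1))
  ultimately show ?thesis using that by blast
qed

section \<open>Feasible points of the reformulation\<close>

lemma inner_one_vec: "(1 :: real ^ 'n) \<bullet> y = (\<Sum>i\<in>UNIV. y $ i)"
  by (simp add: inner_vec_def)

lemma sum_indicator_zeros:
  fixes x :: "real ^ 'n"
  shows "(\<Sum>i\<in>UNIV. if x $ i = 0 then 1 else 0) = real CARD('n) - real (l0 x)"
proof -
  have "real (card {i. x $ i = 0}) + real (l0 x) = real CARD('n)"
    unfolding l0_def of_nat_add[symmetric]
    by (subst card_Un_disjoint[symmetric]) (auto intro!: arg_cong[where f = card])
  moreover have "(\<Sum>i\<in>UNIV. if x $ i = 0 then 1 else 0) = real (card {i. x $ i = 0})"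
    by (simp add: sum.If_cases)
  ultimately show ?thesis by linarith
qed

text \<open>Complementarity and \<open>y \<le> e\<close> bound \<open>y\<close> by the indicator of the zeros of \<open>x\<close>, whose entries add
  up to \<open>n - \<parallel>x\<parallel>\<^sub>0\<close>.\<close>

lemma feasR_le_indicator_zeros:
  assumes "(x, y) \<in> feasR m p g h \<kappa>"
  shows "y $ i \<le> (if x $ i = 0 then 1 else 0)"
proof -
  have "x $ i * y $ i = 0" "y $ i \<le> 1"
    using assms by (auto simp: feasR_def vec_eq_iff less_eq_vec_def)
  then show ?thesis by auto
qed

lemma feasR_imp_feasP:
  fixes x :: "real ^ 'n"
  assumes "(x, y) \<in> feasR m p g h \<kappa>"
  shows "x \<in> feasP m p g h \<kappa>"
proof -
  have "real CARD('n) - real_of_int \<kappa> \<le> (\<Sum>i\<in>UNIV. y $ i)"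
    using assms by (auto simp: feasR_def inner_one_vec)
  also have "\<dots> \<le> real CARD('n) - real (l0 x)"
    unfolding sum_indicator_zeros[symmetric] by (intro sum_mono feasR_le_indicator_zeros[OF assms])
  finally have "real (l0 x) \<le> real_of_int \<kappa>" by simp
  with assms show ?thesis by (auto simp: feasR_def feasP_def)
qed

lemma feasP_imp_feasR:
  assumes "x \<in> feasP m p g h \<kappa>"
  shows "(x, \<chi> i. if x $ i = 0 then 1 else 0) \<in> feasR m p g h \<kappa>"
proof -
  have "real (l0 x) \<le> real_of_int \<kappa>" using assms by (simp add: feasP_def)
  then show ?thesis
    using assms by (auto simp: feasR_def feasP_def inner_one_vec sum_indicator_zeros less_eq_vec_def vec_eq_iff)
qed

text \<open>When the cardinality bound is attained, both sums in the preceding argument equal \<open>n - \<kappa>\<close>, so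
  the componentwise bound is an equality and \<open>y\<close> is unique.\<close>

lemma feasR_snd_eq_indicator_zeros:
  fixes x :: "real ^ 'n"
  assumes "(x, y) \<in> feasR m p g h \<kappa>" and "int (l0 x) = \<kappa>"
  shows "y = (\<chi> i. if x $ i = 0 then 1 else 0)"
proof -
  let ?d = "\<lambda>i. (if x $ i = 0 then 1 else 0) - y $ i"
  have nn: "0 \<le> ?d i" for i using feasR_le_indicator_zeros[OF assms(1), of i] by simp
  have "real CARD('n) - real (l0 x) \<le> (\<Sum>i\<in>UNIV. y $ i)"
    using assms by (auto simp: feasR_def inner_one_vec)
  then have "(\<Sum>i\<in>UNIV. ?d i) \<le> 0" unfolding sum_subtractf sum_indicator_zeros by linarith
  moreover have "(\<Sum>i\<in>UNIV. ?d i) \<ge> 0" by (intro sum_nonneg nn)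
  ultimately have "(\<Sum>i\<in>UNIV. ?d i) = 0" by linarith
  then have "\<forall>i. ?d i = 0" using nn by (subst (asm) sum_nonneg_eq_0_iff) auto
  then show ?thesis by (auto simp: vec_eq_iff)
qed

lemma feasR_subset_feasNLP:
  assumes "t \<ge> 0"
  shows "feasR m p g h \<kappa> \<subseteq> feasNLP m p g h \<kappa> t"
proof -
  have "x * y = 0 \<Longrightarrow> - (t *\<^sub>R 1) \<le> x * y \<and> x * y \<le> t *\<^sub>R 1" for x y :: "real ^ 'a"
    using assms by (simp add: less_eq_vec_def)
  then show ?thesis unfolding feasR_def feasNLP_def by blast
qed

text \<open>Each of the finitely many conditions \<open>x $ i \<noteq> 0\<close> is open, so one radius serves all of them.\<close>

lemma support_mono_near:
  fixes a :: "real ^ 'n"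
  obtains \<delta> where "\<delta> > 0" "\<And>x. dist a x \<le> \<delta> \<Longrightarrow> {i. a $ i \<noteq> 0} \<subseteq> {i. x $ i \<noteq> 0}"
proof -
  have "\<forall>i. \<forall>\<^sub>F x in nhds a. a $ i \<noteq> 0 \<longrightarrow> x $ i \<noteq> 0"
  proof
    fix i
    have "open {x :: real ^ 'n. x $ i \<noteq> 0}" by (intro open_Collect_neq continuous_intros)
    then show "\<forall>\<^sub>F x in nhds a. a $ i \<noteq> 0 \<longrightarrow> x $ i \<noteq> 0"
      by (cases "a $ i = 0") (auto dest: eventually_nhds_in_open)
  qed
  then have "\<forall>\<^sub>F x in nhds a. \<forall>i. a $ i \<noteq> 0 \<longrightarrow> x $ i \<noteq> 0" by (simp add: eventually_all_finite)
  then obtain d where "d > 0" "\<And>x. dist x a < d \<Longrightarrow> \<forall>i. a $ i \<noteq> 0 \<longrightarrow> x $ i \<noteq> 0"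
    unfolding eventually_nhds_metric by blast
  then show ?thesis by (intro that[of "d / 2"]) (auto simp: dist_commute)
qed

section \<open>Strictness over a closed ball\<close>

text \<open>The common form to which both kinds of strict local minima reduce: \<open>x\<close> is confined to a ball
  of the Euclidean norm, \<open>y\<close> is unrestricted.\<close>

definition strict_min_over_cball ::
    "('a::metric_space \<Rightarrow> real) \<Rightarrow> ('a \<times> 'b) set \<Rightarrow> 'a \<Rightarrow> real \<Rightarrow> bool" where
  "strict_min_over_cball F S a \<delta> \<longleftrightarrow>
     a \<in> fst ` S \<and> (\<forall>(x, y) \<in> S. x \<in> cball a \<delta> \<and> x \<noteq> a \<longrightarrow> F a < F x)"

lemma nball_contains_cball:
  fixes N :: "'a::euclidean_space \<Rightarrow> real"
  assumes "is_norm N" and "\<rho> > 0"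
  obtains \<delta> where "\<delta> > 0" "cball a \<delta> \<subseteq> nball N a \<rho>"
proof -
  obtain B where B: "B > 0" "\<And>x. N x \<le> B * norm x" using is_norm_le_norm[OF assms(1)] by blast
  have "cball a (\<rho> / (2 * B)) \<subseteq> nball N a \<rho>"
  proof
    fix x assume "x \<in> cball a (\<rho> / (2 * B))"
    then have "B * norm (x - a) \<le> B * (\<rho> / (2 * B))"
      using B(1) by (intro mult_left_mono) (auto simp: dist_norm norm_minus_commute)
    also have "\<dots> < \<rho>" using B(1) assms(2) by simp
    finally show "x \<in> nball N a \<rho>" using B(2)[of "x - a"] by (simp add: nball_def)
  qed
  then show ?thesis using B(1) assms(2) by (intro that[of "\<rho> / (2 * B)"]) auto
qed

lemma strict_local_minimum_feasP_imp_cball: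
  assumes "is_norm N" and "strict_local_minimum N f (feasP m p g h \<kappa>) xs"
  obtains \<delta> where "\<delta> > 0" "strict_min_over_cball f (feasR m p g h \<kappa>) xs \<delta>"
proof -
  obtain \<rho> where feas: "xs \<in> feasP m p g h \<kappa>" and "\<rho> > 0"
    and strict: "\<forall>x \<in> (nball N xs \<rho> - {xs}) \<inter> feasP m p g h \<kappa>. f xs < f x"
    using assms(2) unfolding strict_local_minimum_def by (elim conjE exE)
  obtain \<delta> where \<delta>: "\<delta> > 0" "cball xs \<delta> \<subseteq> nball N xs \<rho>"
    by (rule nball_contains_cball[OF assms(1) \<open>\<rho> > 0\<close>])
  have "strict_min_over_cball f (feasR m p g h \<kappa>) xs \<delta>"
    unfolding strict_min_over_cball_def
  proof (intro conjI)
    show "xs \<in> fst ` feasR m p g h \<kappa>" using feasP_imp_feasR[OF feas] by force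
    show "\<forall>(x, y) \<in> feasR m p g h \<kappa>. x \<in> cball xs \<delta> \<and> x \<noteq> xs \<longrightarrow> f xs < f x"
      using strict \<delta>(2) by (blast dest: feasR_imp_feasP)
  qed
  with \<delta>(1) show ?thesis using that by blast
qed

text \<open>Near \<open>xs\<close> supports can only grow, while feasibility caps their size at \<open>\<kappa>\<close>; so a feasible \<open>x\<close>
  near \<open>xs\<close> has the support of \<open>xs\<close>, and \<open>y = ys\<close> is forced. Thus closeness of \<open>x\<close> to \<open>xs\<close> alone puts
  \<open>(x, y)\<close> into the neighbourhood where strictness is given.\<close>

lemma strict_local_minimum_wrt_x_feasR_imp_cball:
  fixes xs :: "real ^ 'n"
  assumes "is_norm N2"
    and "strict_local_minimum_wrt_x N2 f (feasR m p g h \<kappa>) (xs, ys)" and "int (l0 xs) = \<kappa>"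
  obtains \<delta> where "\<delta> > 0" "strict_min_over_cball f (feasR m p g h \<kappa>) xs \<delta>"
proof -
  obtain \<rho> where feas: "(xs, ys) \<in> feasR m p g h \<kappa>" and "\<rho> > 0"
    and strict: "\<forall>(x, y) \<in> nball N2 (xs, ys) \<rho> \<inter> feasR m p g h \<kappa>. x \<noteq> xs \<longrightarrow> f xs < f x"
    using assms(2) unfolding strict_local_minimum_wrt_x_def fst_conv by (elim conjE exE)
  obtain \<delta>1 where \<delta>1: "\<delta>1 > 0" "cball (xs, ys) \<delta>1 \<subseteq> nball N2 (xs, ys) \<rho>"
    by (rule nball_contains_cball[OF assms(1) \<open>\<rho> > 0\<close>])
  obtain \<delta>2 where \<delta>2: "\<delta>2 > 0"
    "\<And>x. dist xs x \<le> \<delta>2 \<Longrightarrow> {i. xs $ i \<noteq> 0} \<subseteq> {i. x $ i \<noteq> 0}"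
    using support_mono_near[of xs] by blast
  have "f xs < f x"
    if R: "(x, y) \<in> feasR m p g h \<kappa>" and near: "x \<in> cball xs (min \<delta>1 \<delta>2)" and "x \<noteq> xs" for x y
  proof -
    have sub: "{i. xs $ i \<noteq> 0} \<subseteq> {i. x $ i \<noteq> 0}" using near \<delta>2(2) by simp
    have "l0 x \<le> l0 xs" using feasR_imp_feasP[OF R] assms(3) by (auto simp: feasP_def)
    then have "{i. xs $ i \<noteq> 0} = {i. x $ i \<noteq> 0}"
      unfolding l0_def by (intro card_seteq sub) auto
    then have "l0 x = l0 xs" and supp: "\<And>i. x $ i = 0 \<longleftrightarrow> xs $ i = 0" by (auto simp: l0_def)
    then have "y = ys"
      using feasR_snd_eq_indicator_zeros[OF R] feasR_snd_eq_indicator_zeros[OF feas] assms(3) by simp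
    then have "(x, y) \<in> cball (xs, ys) \<delta>1" using near by (simp add: dist_Pair_Pair)
    then show ?thesis using strict \<delta>1(2) R \<open>x \<noteq> xs\<close> by blast
  qed
  moreover have "xs \<in> fst ` feasR m p g h \<kappa>" using feas by force
  ultimately have "strict_min_over_cball f (feasR m p g h \<kappa>) xs (min \<delta>1 \<delta>2)"
    unfolding strict_min_over_cball_def by blast
  with \<delta>1(1) \<delta>2(1) show ?thesis using that[of "min \<delta>1 \<delta>2"] by simp
qed

section \<open>Local minima of the regularized programs\<close>

lemma continuous_on_continuously_differentiable:
  "continuously_differentiable F \<Longrightarrow> continuous_on S F"
  unfolding continuously_differentiable_def
  by (meson continuous_at_imp_continuous_on has_derivative_continuous)

lemma closed_feasX:
  assumes "\<And>i. i < m \<Longrightarrow> continuous_on UNIV (g i)" and "\<And>j. j < p \<Longrightarrow> continuous_on UNIV (h j)"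
  shows "closed (feasX m p g h)"
proof -
  have eq: "feasX m p g h = (\<Inter>i\<in>{..<m}. {x. g i x \<le> 0}) \<inter> (\<Inter>j\<in>{..<p}. {x. h j x = 0})"
    by (auto simp: feasX_def)
  show ?thesis unfolding eq using assms
    by (intro closed_Int closed_INT ballI closed_Collect_le closed_Collect_eq) auto
qed

text \<open>The constraints of (R) apart from the complementarity condition.\<close>

definition relaxed_feas ::
    "nat \<Rightarrow> nat \<Rightarrow> (nat \<Rightarrow> real ^ 'n \<Rightarrow> real) \<Rightarrow> (nat \<Rightarrow> real ^ 'n \<Rightarrow> real) \<Rightarrow> int
      \<Rightarrow> ((real ^ 'n) \<times> (real ^ 'n)) set" where
  "relaxed_feas m p g h \<kappa> =
     feasX m p g h \<times> ({0..1} \<inter> {y. 1 \<bullet> y \<ge> real CARD('n) - real_of_int \<kappa>})"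

lemma feasNLP_eq_relaxed_infnorm:
  "feasNLP m p g h \<kappa> t = relaxed_feas m p g h \<kappa> \<inter> {(x, y). infnorm (x * y) \<le> t}"
proof -
  have "- (t *\<^sub>R 1) \<le> z \<and> z \<le> t *\<^sub>R 1 \<longleftrightarrow> infnorm z \<le> t" for z :: "real ^ 'a"
  proof -
    have "- (t *\<^sub>R 1) \<le> z \<and> z \<le> t *\<^sub>R 1 \<longleftrightarrow> (\<forall>i. \<bar>z $ i\<bar> \<le> t)"
      by (auto simp: less_eq_vec_def abs_le_iff minus_le_iff)
    also have "\<dots> \<longleftrightarrow> infnorm z \<le> t"
    proof
      show "infnorm z \<le> t" if "\<forall>i. \<bar>z $ i\<bar> \<le> t"
        unfolding infnorm_cart using that by (intro cSup_least) auto
      show "\<forall>i. \<bar>z $ i\<bar> \<le> t" if "infnorm z \<le> t"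
        using that component_le_infnorm_cart order_trans by blast
    qed
    finally show ?thesis .
  qed
  then show ?thesis by (auto simp: feasNLP_def relaxed_feas_def)
qed

lemma feasR_eq_relaxed_infnorm:
  "feasR m p g h \<kappa> = relaxed_feas m p g h \<kappa> \<inter> {(x, y). infnorm (x * y) = 0}"
  by (auto simp: feasR_def relaxed_feas_def infnorm_eq_0)

lemma compact_relaxed_feas:
  assumes "closed (feasX m p g h)" and "compact C"
  shows "compact (relaxed_feas m p g h \<kappa> \<inter> C \<times> UNIV)"
proof -
  have eq: "relaxed_feas m p g h \<kappa> \<inter> C \<times> UNIV =
    (C \<inter> feasX m p g h) \<times> ({0..1} \<inter> {y. 1 \<bullet> y \<ge> real CARD('a) - real_of_int \<kappa>})"
    by (auto simp: relaxed_feas_def)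
  have "compact {0..1 :: real ^ 'a}" by (simp add: interval_cbox[symmetric])
  then show ?thesis unfolding eq using assms
    by (intro compact_Times compact_Int_closed closed_Collect_le continuous_intros) auto
qed

lemma continuous_on_infnorm_mult:
  "continuous_on S (\<lambda>z. infnorm (fst z * snd z :: real ^ 'n))"
  unfolding times_vec_def by (intro continuous_intros)

text \<open>The points of a relaxed program over the sphere that are at least as good as \<open>a\<close> form a compact
  set on which the complementarity residual \<open>infnorm (x * y)\<close> cannot vanish.\<close>

lemma sphere_not_competitive:
  fixes f :: "real ^ 'n \<Rightarrow> real"
  assumes "closed (feasX m p g h)" and "continuous_on UNIV f"
    and "\<delta> > 0" and "strict_min_over_cball f (feasR m p g h \<kappa>) a \<delta>"
  obtains T where "T > 0"
    "\<And>t x y. t \<le> T \<Longrightarrow> (x, y) \<in> feasNLP m p g h \<kappa> t \<Longrightarrow> x \<in> sphere a \<delta> \<Longrightarrow> f a < f x"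
proof -
  define S where "S = relaxed_feas m p g h \<kappa> \<inter> (sphere a \<delta> \<inter> {x. f x \<le> f a}) \<times> UNIV"
  have "compact (sphere a \<delta> \<inter> {x. f x \<le> f a})"
    using assms(2) by (intro compact_Int_closed closed_Collect_le) auto
  then have "compact S" unfolding S_def by (rule compact_relaxed_feas[OF assms(1)])
  have pos: "infnorm (x * y) > 0" if "(x, y) \<in> S" for x y
  proof (rule ccontr)
    assume "\<not> infnorm (x * y) > 0"
    then have "infnorm (x * y) = 0" using infnorm_pos_le[of "x * y"] by linarith
    with that have "(x, y) \<in> feasR m p g h \<kappa>" by (auto simp: S_def feasR_eq_relaxed_infnorm)
    with that assms(3,4) show False by (fastforce simp: S_def strict_min_over_cball_def)
  qed
  obtain T where "T > 0" and T: "\<And>x y. (x, y) \<in> S \<Longrightarrow> T < infnorm (x * y)"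
  proof (cases "S = {}")
    case True
    then show ?thesis using that[of 1] by simp
  next
    case False
    then obtain w where w: "w \<in> S" "\<forall>z\<in>S. infnorm (fst w * snd w) \<le> infnorm (fst z * snd z)"
      using continuous_attains_inf[OF \<open>compact S\<close> False continuous_on_infnorm_mult] by blast
    have "0 < infnorm (fst w * snd w)" using pos[of "fst w" "snd w"] w(1) by simp
    \<comment> \<open>Half of the minimum, so that the bound on \<open>S\<close> is strict and \<open>t = T\<close> is admissible.\<close>
    with w(2) show ?thesis using that[of "infnorm (fst w * snd w) / 2"] by fastforce
  qed
  have "f a < f x" if "t \<le> T" "(x, y) \<in> feasNLP m p g h \<kappa> t" "x \<in> sphere a \<delta>" for t x y
  proof (rule ccontr)
    assume "\<not> f a < f x"
    with that have "(x, y) \<in> S" by (auto simp: S_def feasNLP_eq_relaxed_infnorm)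
    with T that show False by (fastforce simp: feasNLP_eq_relaxed_infnorm)
  qed
  with \<open>T > 0\<close> show ?thesis using that by blast
qed

text \<open>Local minima do not depend on the norm, so an open ball in the \<open>x\<close>-component suffices.\<close>

lemma local_minimum_if_min_over_ball:
  fixes N2 :: "'a::euclidean_space \<times> 'b::euclidean_space \<Rightarrow> real"
  assumes "is_norm N2" and "(u, v) \<in> S" and "u \<in> ball a \<delta>"
    and le: "\<And>x y. (x, y) \<in> S \<Longrightarrow> x \<in> ball a \<delta> \<Longrightarrow> F u \<le> F x"
  shows "local_minimum N2 (\<lambda>(x, y). F x) S (u, v)"
proof -
  obtain A where A: "A > 0" "\<And>z. A * norm z \<le> N2 z" using norm_le_is_norm[OF assms(1)] by blast
  obtain e where e: "e > 0" "ball u e \<subseteq> ball a \<delta>"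
    using assms(3) open_ball open_contains_ball by blast
  have "F u \<le> F x" if "(x, y) \<in> nball N2 (u, v) (A * e)" "(x, y) \<in> S" for x y
  proof -
    have "A * norm (x - u) \<le> A * norm ((x, y) - (u, v))"
      using A(1) norm_fst_le[of "x - u" "y - v"] by simp
    also have "\<dots> < A * e" using that(1) A(2)[of "(x, y) - (u, v)"] by (simp add: nball_def)
    finally have "x \<in> ball u e" using A(1) by (simp add: dist_norm norm_minus_commute)
    with e(2) show ?thesis by (intro le[OF that(2)]) auto
  qed
  with A(1) e(1) assms(2) show ?thesis
    unfolding local_minimum_def by (intro conjI exI[of _ "A * e"]) auto
qed

lemma feasNLP_local_minimum_near_strict_min:
  fixes f :: "real ^ 'n \<Rightarrow> real"
  assumes "is_norm N" and "is_norm N2"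
    and closed: "closed (feasX m p g h)" and cont: "continuous_on UNIV f"
    and "\<delta> > 0" and strict: "strict_min_over_cball f (feasR m p g h \<kappa>) a \<delta>"
  shows "\<exists>r>0. \<exists>T>0. \<forall>t\<in>{0<..T}. \<exists>u v.
    local_minimum N2 (\<lambda>(x, y). f x) (feasNLP m p g h \<kappa> t) (u, v) \<and> u \<in> nball N a r"
proof -
  obtain T where "T > 0" and T: "\<And>t x y. t \<le> T \<Longrightarrow> (x, y) \<in> feasNLP m p g h \<kappa> t \<Longrightarrow>
      x \<in> sphere a \<delta> \<Longrightarrow> f a < f x"
    using sphere_not_competitive[OF closed cont \<open>\<delta> > 0\<close> strict] by blast
  obtain B where B: "B > 0" "\<And>x. N x \<le> B * norm x" using is_norm_le_norm[OF assms(1)] by blast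
  obtain b where b: "(a, b) \<in> feasR m p g h \<kappa>"
    using strict by (force simp: strict_min_over_cball_def)
  have "\<exists>u v. local_minimum N2 (\<lambda>(x, y). f x) (feasNLP m p g h \<kappa> t) (u, v) \<and> u \<in> nball N a (B * \<delta>)"
    if t: "t \<in> {0<..T}" for t
  proof -
    let ?F = "feasNLP m p g h \<kappa> t"
    let ?K = "?F \<inter> cball a \<delta> \<times> UNIV"
    have "closed {z :: (real ^ 'n) \<times> (real ^ 'n). infnorm (fst z * snd z) \<le> t}"
      by (intro closed_Collect_le continuous_on_infnorm_mult continuous_on_const)
    then have "compact (relaxed_feas m p g h \<kappa> \<inter> cball a \<delta> \<times> UNIV \<inter>
        {z. infnorm (fst z * snd z) \<le> t})"
      by (intro compact_Int_closed compact_relaxed_feas closed compact_cball)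
    also have "relaxed_feas m p g h \<kappa> \<inter> cball a \<delta> \<times> UNIV \<inter>
        {z. infnorm (fst z * snd z) \<le> t} = ?K"
      by (auto simp: feasNLP_eq_relaxed_infnorm)
    finally have "compact ?K" .
    moreover have a: "(a, b) \<in> ?K"
      using b feasR_subset_feasNLP[of t m p g h \<kappa>] t \<open>\<delta> > 0\<close> by auto
    moreover have "continuous_on ?K (\<lambda>z. f (fst z))"
      by (intro continuous_on_compose2[OF cont] continuous_intros) auto
    ultimately obtain u v where uv: "(u, v) \<in> ?K" "\<And>x y. (x, y) \<in> ?K \<Longrightarrow> f u \<le> f x"
      using continuous_attains_inf[of ?K "\<lambda>z. f (fst z)"] by (metis empty_iff fst_conv surj_pair)
    have "u \<notin> sphere a \<delta>" using T[of t u v] t uv(1) uv(2)[OF a] by auto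
    then have u: "u \<in> ball a \<delta>" using uv(1) by auto
    have "local_minimum N2 (\<lambda>(x, y). f x) ?F (u, v)"
      using uv u by (intro local_minimum_if_min_over_ball[OF assms(2) _ u]) auto
    moreover have "N (u - a) < B * \<delta>"
    proof -
      have "N (u - a) \<le> B * norm (u - a)" by (rule B(2))
      also have "\<dots> < B * \<delta>" using u B(1) by (simp add: dist_norm norm_minus_commute)
      finally show ?thesis .
    qed
    ultimately show ?thesis unfolding nball_def by blast
  qed
  moreover have "B * \<delta> > 0" using B(1) \<open>\<delta> > 0\<close> by simp
  ultimately show ?thesis using \<open>T > 0\<close> by blast
qed

theorem theorem4p3:
  fixes f :: "real ^ 'n \<Rightarrow> real"
    and g h :: "nat \<Rightarrow> real ^ 'n \<Rightarrow> real"
    and m p :: nat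
    and \<kappa> :: int
    and N :: "real ^ 'n \<Rightarrow> real"
    and N2 :: "(real ^ 'n) \<times> (real ^ 'n) \<Rightarrow> real"
  assumes "is_norm N" and "is_norm N2"
    and "continuously_differentiable f"
    and "\<And>i. i < m \<Longrightarrow> continuously_differentiable (g i)"
    and "\<And>j. j < p \<Longrightarrow> continuously_differentiable (h j)"
    and "\<kappa> < int CARD('n)"
    and "feasP m p g h \<kappa> \<noteq> {}"
  shows
    "(\<forall>xs. strict_local_minimum N f (feasP m p g h \<kappa>) xs \<longrightarrow>
        (\<exists>r>0. \<exists>T>0. \<forall>t\<in>{0<..T}. \<exists>xt yt.
           local_minimum N2 (\<lambda>(x, y). f x) (feasNLP m p g h \<kappa> t) (xt, yt) \<and> xt \<in> nball N xs r))
     \<and>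
     (\<forall>xs ys. strict_local_minimum_wrt_x N2 f (feasR m p g h \<kappa>) (xs, ys) \<and> int (l0 xs) = \<kappa> \<longrightarrow>
        (\<exists>r>0. \<exists>T>0. \<forall>t\<in>{0<..T}. \<exists>xt yt.
           local_minimum N2 (\<lambda>(x, y). f x) (feasNLP m p g h \<kappa> t) (xt, yt) \<and> xt \<in> nball N xs r))"
proof -
  have closed: "closed (feasX m p g h)"
    using assms(4,5) by (intro closed_feasX continuous_on_continuously_differentiable) auto
  have cont: "continuous_on UNIV f"
    by (rule continuous_on_continuously_differentiable[OF assms(3)])
  note near = feasNLP_local_minimum_near_strict_min[OF assms(1,2) closed cont]
  show ?thesis
  proof (intro conjI allI impI)
    fix xs assume "strict_local_minimum N f (feasP m p g h \<kappa>) xs"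
    then obtain \<delta> where "\<delta> > 0" "strict_min_over_cball f (feasR m p g h \<kappa>) xs \<delta>"
      using strict_local_minimum_feasP_imp_cball[OF assms(1)] by blast
    then show "\<exists>r>0. \<exists>T>0. \<forall>t\<in>{0<..T}. \<exists>xt yt.
      local_minimum N2 (\<lambda>(x, y). f x) (feasNLP m p g h \<kappa> t) (xt, yt) \<and> xt \<in> nball N xs r"
      by (rule near)
  next
    fix xs ys
    assume "strict_local_minimum_wrt_x N2 f (feasR m p g h \<kappa>) (xs, ys) \<and> int (l0 xs) = \<kappa>"
    then obtain \<delta> where "\<delta> > 0" "strict_min_over_cball f (feasR m p g h \<kappa>) xs \<delta>"
      using strict_local_minimum_wrt_x_feasR_imp_cball[OF assms(2)] by blast
    then show "\<exists>r>0. \<exists>T>0. \<forall>t\<in>{0<..T}. \<exists>xt yt.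
      local_minimum N2 (\<lambda>(x, y). f x) (feasNLP m p g h \<kappa> t) (xt, yt) \<and> xt \<in> nball N xs r"
      by (rule near)
  qed
qed

end
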